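(* For every $w\in F(a,b)$, the trace polynomial $f_w$ satisfies \[ f_w(0,0,0)\in\{-2,0,2\}. \]
   Context: $F(a,b)$ is the free group on $a,b$. For $w\in F(a,b)$ and $A,B\in \mathrm{SL}(2,\mathbb C)$, $w(A,B)$ denotes the image of $w$ under $a\mapsto A$, $b\mapsto B$. The trace polynomial $f_w(x,y,z)\in\mathbb Z[x,y,z]$ is the unique polynomial such that $\mathrm{Tr}(w(A,B))=f_w(\mathrm{Tr}A,\mathrm{Tr}B,\mathrm{Tr}(AB))$ for all $A,B\in \mathrm{SL}(2,\mathbb C)$ (its existence and uniqueness are classical). *)

theory Defs
  imports "HOL-Algebra.Group" "HOL-Analysis.Determinants"
    "HOL-Computational_Algebra.Polynomial"
begin

text \<open>
  The free group on the elements of the type \<^typ>\<open>'g\<close>, realised on reduced words.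
  The letter \<open>(g, True)\<close> stands for the generator \<open>g\<close> and \<open>(g, False)\<close> for its inverse.
\<close>

type_synonym 'g letter = "'g \<times> bool"

definition inv_letter :: "'g letter \<Rightarrow> 'g letter" where
  "inv_letter l = (fst l, \<not> snd l)"

fun reduced :: "'g letter list \<Rightarrow> bool" where
  "reduced (k # l # ls) \<longleftrightarrow> l \<noteq> inv_letter k \<and> reduced (l # ls)"
| "reduced _ \<longleftrightarrow> True"

fun push :: "'g letter \<Rightarrow> 'g letter list \<Rightarrow> 'g letter list" where
  "push k [] = [k]"
| "push k (l # ls) = (if l = inv_letter k then ls else k # l # ls)"

definition free_reduce :: "'g letter list \<Rightarrow> 'g letter list" where
  "free_reduce w = foldr push w []"

definition free_group :: "'g letter list monoid" where
  "free_group = \<lparr>carrier = {w. reduced w}, monoid.mult = (\<lambda>v w. free_reduce (v @ w)), one = []\<rparr>"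

definition generator :: "'g \<Rightarrow> 'g letter list" where
  "generator g = [(g, True)]"

definition letter_value :: "('b, 'm) monoid_scheme \<Rightarrow> ('g \<Rightarrow> 'b) \<Rightarrow> 'g letter \<Rightarrow> 'b" where
  "letter_value G \<phi> l = (if snd l then \<phi> (fst l) else inv\<^bsub>G\<^esub> (\<phi> (fst l)))"

definition free_lift :: "('b, 'm) monoid_scheme \<Rightarrow> ('g \<Rightarrow> 'b) \<Rightarrow> 'g letter list \<Rightarrow> 'b" where
  "free_lift G \<phi> w = foldr (\<lambda>l h. letter_value G \<phi> l \<otimes>\<^bsub>G\<^esub> h) w \<one>\<^bsub>G\<^esub>"

lemma inv_letter_inv_letter [simp]: "inv_letter (inv_letter l) = l"
  by (simp add: inv_letter_def)

lemma reduced_tl: "reduced (l # ls) \<Longrightarrow> reduced ls"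
  by (cases ls) auto

lemma reduced_push: "reduced w \<Longrightarrow> reduced (push l w)"
  by (cases w) (auto dest: reduced_tl)

lemma reduced_foldr_push: "reduced w \<Longrightarrow> reduced (foldr push v w)"
  by (induction v) (auto intro: reduced_push)

lemma free_reduce_reduced: "reduced w \<Longrightarrow> free_reduce w = w"
proof (induction w)
  case (Cons l ls)
  then show ?case
    by (cases ls) (auto simp: free_reduce_def)
qed (simp add: free_reduce_def)

lemma push_push_inv:
  assumes "reduced w"
  shows "push l (push (inv_letter l) w) = w"
proof (cases w)
  case (Cons k ks)
  then show ?thesis
    using assms by (cases ks) auto
qed simp

lemma foldr_push_push:
  assumes "reduced w"
  shows "foldr push (push l v) w = push l (foldr push v w)"
proof (cases v)
  case (Cons k ks)
  then show ?thesis
    using push_push_inv[OF reduced_foldr_push[OF assms], of l ks] by auto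
qed simp

lemma foldr_push_foldr_push:
  assumes "reduced w"
  shows "foldr push (foldr push u v) w = foldr push u (foldr push v w)"
  by (induction u) (simp_all add: foldr_push_push[OF assms])

lemma foldr_push_free_reduce:
  "reduced w \<Longrightarrow> foldr push (free_reduce v) w = foldr push v w"
  by (simp add: free_reduce_def foldr_push_foldr_push)

lemma free_reduce_append: "free_reduce (v @ w) = foldr push v (free_reduce w)"
  by (simp add: free_reduce_def)

lemma reduced_free_reduce: "reduced (free_reduce w)"
  by (simp add: free_reduce_def reduced_foldr_push)

lemma foldr_push_inverse:
  "reduced w \<Longrightarrow> foldr push (rev (map inv_letter v)) (foldr push v w) = w"
proof (induction v)
  case (Cons l v)
  then show ?case
    using push_push_inv[OF reduced_foldr_push[OF Cons.prems], of "inv_letter l" v] by simp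
qed simp

lemma group_free_group: "group free_group"
proof (rule groupI)
  fix u v w :: "'g letter list"
  assume "u \<in> carrier free_group" "v \<in> carrier free_group" "w \<in> carrier free_group"
  then show "u \<otimes>\<^bsub>free_group\<^esub> v \<otimes>\<^bsub>free_group\<^esub> w = u \<otimes>\<^bsub>free_group\<^esub> (v \<otimes>\<^bsub>free_group\<^esub> w)"
    by (simp add: free_group_def free_reduce_append foldr_push_foldr_push
        reduced_free_reduce free_reduce_reduced reduced_foldr_push)
next
  fix v :: "'g letter list"
  assume v: "v \<in> carrier free_group"
  let ?v' = "free_reduce (rev (map inv_letter v))"
  have "?v' \<otimes>\<^bsub>free_group\<^esub> v = \<one>\<^bsub>free_group\<^esub>"
    using foldr_push_inverse[of "[]" v]
    by (simp add: free_group_def free_reduce_append foldr_push_free_reduce reduced_free_reduce)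
      (simp add: free_reduce_def)
  then show "\<exists>u\<in>carrier free_group. u \<otimes>\<^bsub>free_group\<^esub> v = \<one>\<^bsub>free_group\<^esub>"
    by (intro bexI[of _ ?v']) (auto simp: free_group_def reduced_free_reduce)
qed (auto simp: free_group_def reduced_free_reduce free_reduce_reduced)

context
  fixes G :: "('b, 'm) monoid_scheme" and \<phi> :: "'g \<Rightarrow> 'b"
  assumes group_G: "group G" and range_\<phi>: "\<And>g. \<phi> g \<in> carrier G"
begin

interpretation group G by (rule group_G)

lemma letter_value_closed: "letter_value G \<phi> l \<in> carrier G"
  by (simp add: letter_value_def range_\<phi>)

lemma free_lift_closed: "free_lift G \<phi> w \<in> carrier G"
  by (induction w) (simp_all add: free_lift_def letter_value_closed)

lemma letter_value_inv: "letter_value G \<phi> (inv_letter l) = inv\<^bsub>G\<^esub> (letter_value G \<phi> l)"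
  by (simp add: letter_value_def inv_letter_def range_\<phi>)

lemma free_lift_Cons: "free_lift G \<phi> (l # w) = letter_value G \<phi> l \<otimes>\<^bsub>G\<^esub> free_lift G \<phi> w"
  by (simp add: free_lift_def)

lemma free_lift_append: "free_lift G \<phi> (v @ w) = free_lift G \<phi> v \<otimes>\<^bsub>G\<^esub> free_lift G \<phi> w"
proof (induction v)
  case Nil
  show ?case using free_lift_closed[of w] by (simp add: free_lift_def)
next
  case (Cons l v)
  then show ?case
    by (simp add: free_lift_Cons m_assoc letter_value_closed free_lift_closed)
qed

lemma free_lift_push: "free_lift G \<phi> (push l w) = letter_value G \<phi> l \<otimes>\<^bsub>G\<^esub> free_lift G \<phi> w"
proof (cases w)
  case (Cons k ks)
  show ?thesis
    using Cons letter_value_closed free_lift_closed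
    by (simp add: free_lift_Cons letter_value_inv flip: m_assoc)
qed (simp add: free_lift_def)

lemma free_lift_free_reduce: "free_lift G \<phi> (free_reduce w) = free_lift G \<phi> w"
  by (induction w) (simp_all add: free_reduce_def free_lift_push free_lift_Cons)

lemma free_lift_hom: "free_lift G \<phi> \<in> hom free_group G"
  by (auto simp: hom_def free_group_def free_lift_closed free_lift_free_reduce free_lift_append)

lemma free_lift_generator: "free_lift G \<phi> (generator g) = \<phi> g"
  by (simp add: free_lift_def generator_def letter_value_def range_\<phi>)

lemma free_lift_unique:
  assumes h: "h \<in> hom free_group G" and gen: "\<And>g. h (generator g) = \<phi> g"
    and w: "w \<in> carrier free_group"
  shows "h w = free_lift G \<phi> w"
proof -
  interpret F: group "free_group :: 'g letter list monoid" by (rule group_free_group)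
  interpret H: group_hom "free_group :: 'g letter list monoid" G h
    by unfold_locales (rule h)
  have inv_gen: "inv\<^bsub>free_group\<^esub> (generator g) = [(g, False)]" for g :: 'g
    by (rule F.inv_equality)
      (simp_all add: free_group_def generator_def free_reduce_def inv_letter_def)
  have gen_closed: "generator g \<in> carrier free_group" for g :: 'g
    by (simp add: free_group_def generator_def)
  have letter: "h [l] = letter_value G \<phi> l" for l
  proof (cases l)
    case (Pair g e)
    show ?thesis
      using gen[of g] H.hom_inv[OF gen_closed[of g]]
      by (cases e) (auto simp: Pair letter_value_def inv_gen, simp add: generator_def)
  qed
  have "reduced w \<Longrightarrow> h w = free_lift G \<phi> w"
  proof (induction w)
    case Nil
    then show ?case
      using H.hom_one by (simp add: free_group_def free_lift_def)
  next
    case (Cons l w)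
    have "l # w = [l] \<otimes>\<^bsub>free_group\<^esub> w"
      using Cons.prems by (simp add: free_group_def free_reduce_reduced)
    moreover have "[l] \<in> carrier free_group" "w \<in> carrier free_group"
      using reduced_tl[OF Cons.prems] by (simp_all add: free_group_def)
    ultimately have "h (l # w) = h [l] \<otimes>\<^bsub>G\<^esub> h w"
      by simp
    then show ?case
      using Cons.IH reduced_tl[OF Cons.prems] by (simp add: letter free_lift_Cons)
  qed
  with w show ?thesis by (simp add: free_group_def)
qed

end

datatype gen = gen_a | gen_b

abbreviation F_ab :: "gen letter list monoid" where
  "F_ab \<equiv> free_group"

definition SL2C :: "(complex^2^2) monoid" where
  "SL2C = \<lparr>carrier = {A. det A = 1}, monoid.mult = (**), one = mat 1\<rparr>"

lemma group_SL2C: "group SL2C"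
proof (rule groupI)
  fix A assume A: "A \<in> carrier SL2C"
  then have "det A \<noteq> 0" by (simp add: SL2C_def)
  then obtain B where B: "B ** A = mat 1"
    by (metis invertible_def invertible_det_nz)
  with A have "det B = 1"
    by (metis (mono_tags, lifting) SL2C_def det_I det_mul mem_Collect_eq mult.right_neutral partial_object.select_convs(1))
  with B show "\<exists>B\<in>carrier SL2C. B \<otimes>\<^bsub>SL2C\<^esub> A = \<one>\<^bsub>SL2C\<^esub>"
    by (auto simp: SL2C_def)
qed (auto simp: SL2C_def det_mul matrix_mul_assoc)

definition word_eval :: "gen letter list \<Rightarrow> complex^2^2 \<Rightarrow> complex^2^2 \<Rightarrow> complex^2^2" where
  "word_eval w A B = free_lift SL2C (\<lambda>g. case g of gen_a \<Rightarrow> A | gen_b \<Rightarrow> B) w"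

text \<open>
  \<open>\<int>[x,y,z]\<close> is the iterated polynomial ring \<open>\<int>[x][y][z]\<close>: the outermost variable is \<open>z\<close>, the
  innermost one is \<open>x\<close>.
\<close>

type_synonym int_poly3 = "int poly poly poly"

definition eval3 :: "int_poly3 \<Rightarrow> 'a::comm_ring_1 \<Rightarrow> 'a \<Rightarrow> 'a \<Rightarrow> 'a" where
  "eval3 f x y z =
     poly (poly (poly (map_poly (map_poly (map_poly of_int)) f) [:[:z:]:]) [:y:]) x"

definition trace_poly :: "gen letter list \<Rightarrow> int_poly3" where
  "trace_poly w = (THE f. \<forall>A\<in>carrier SL2C. \<forall>B\<in>carrier SL2C.
     trace (word_eval w A B) = eval3 f (trace A) (trace B) (trace (A ** B)))"

end

theory Submission
  imports Defs
begin

text \<open>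
  By the Cayley--Hamilton theorem and its polarization, the span of \<open>I, A, B, AB\<close> is stable under left
  multiplication by \<open>A\<close>, \<open>B\<close> and their inverses, with structure constants in \<open>\<int>[x,y,z]\<close>. Hence
  \<open>w(A,B) = p I + q A + r B + s AB\<close> with \<open>p, q, r, s \<in> \<int>[x,y,z]\<close>, and
  \<open>f\<^sub>w = 2p + xq + yr + zs\<close>; uniqueness holds because every triple in \<open>\<complex>\<^sup>3\<close> is a triple of
  traces. At \<open>x = y = z = 0\<close> the structure constants are those of the
  quaternion group, so exactly one of \<open>p, q, r, s\<close> is nonzero there, it is \<open>1\<close> or \<open>-1\<close>, and
  \<open>f\<^sub>w(0,0,0) = 2p(0,0,0)\<close>.
\<close>

section \<open>Ring homomorphisms and evaluation of polynomials in three variables\<close>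

locale unital_ring_hom =
  fixes h :: "'a::comm_ring_1 \<Rightarrow> 'b::comm_ring_1"
  assumes hom_one: "h 1 = 1"
    and hom_add: "h (a + b) = h a + h b"
    and hom_mult: "h (a * b) = h a * h b"
begin

lemma hom_zero: "h 0 = 0"
  using hom_add[of 0 0] by simp

lemma hom_minus: "h (- a) = - h a"
  using hom_add[of a "- a"] by (simp add: hom_zero eq_neg_iff_add_eq_0 add.commute)

lemma hom_diff: "h (a - b) = h a - h b"
  using hom_add[of a "- b"] by (simp add: hom_minus)

lemma hom_sum: "h (sum g S) = (\<Sum>i\<in>S. h (g i))"
  by (induction S rule: infinite_finite_induct) (simp_all add: hom_zero hom_add)

lemma unital_ring_hom_map_poly: "unital_ring_hom (map_poly h)"
proof
  show "map_poly h 1 = 1"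
    by (simp add: map_poly_1 hom_one)
  show "map_poly h (p + q) = map_poly h p + map_poly h q" for p q
    by (rule poly_eqI) (simp add: coeff_map_poly hom_zero hom_add)
  show "map_poly h (p * q) = map_poly h p * map_poly h q" for p q
    by (rule poly_eqI) (simp add: coeff_map_poly hom_zero coeff_mult hom_sum hom_mult)
qed

end

lemma unital_ring_hom_of_int: "unital_ring_hom of_int"
  by unfold_locales simp_all

lemma unital_ring_hom_poly: "unital_ring_hom (\<lambda>p. poly p c)"
  by unfold_locales simp_all

lemma unital_ring_hom_comp:
  assumes "unital_ring_hom g" "unital_ring_hom h"
  shows "unital_ring_hom (\<lambda>a. g (h a))"
  using assms by (simp add: unital_ring_hom_def)

text \<open>\<open>eval3\<close> composes the threefold coefficientwise \<open>of_int\<close> with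
  three evaluations, and each of these is a ring homomorphism.\<close>

lemma unital_ring_hom_eval3: "unital_ring_hom (\<lambda>f. eval3 f x y z)"
  unfolding eval3_def
  by (rule unital_ring_hom_comp[OF unital_ring_hom_poly]
      unital_ring_hom.unital_ring_hom_map_poly unital_ring_hom_of_int)+

definition "X3 = ([:[:[:0, 1:]:]:] :: int_poly3)"
definition "Y3 = ([:[:0, 1:]:] :: int_poly3)"
definition "Z3 = ([:0, 1:] :: int_poly3)"

lemma eval3_vars [simp]: "eval3 X3 x y z = x" "eval3 Y3 x y z = y" "eval3 Z3 x y z = z"
  by (simp_all add: eval3_def X3_def Y3_def Z3_def map_poly_pCons)

section \<open>Uniqueness of the trace polynomial\<close>

text \<open>A nonzero polynomial over a domain has finitely many roots. The map \<open>g\<close>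
  will embed the complex numbers as constants of a polynomial ring.\<close>

lemma poly_eq_0_if_inj_roots:
  fixes p :: "'a::idom poly" and g :: "'b::ring_char_0 \<Rightarrow> 'a"
  assumes "inj g" and "\<And>c. poly p (g c) = 0"
  shows "p = 0"
proof (rule ccontr)
  assume "p \<noteq> 0"
  moreover have "range g \<subseteq> {a. poly p a = 0}"
    using assms(2) by auto
  ultimately have "finite (range g)"
    using poly_roots_finite finite_subset by blast
  then show False
    using assms(1) infinite_UNIV_char_0[where ?'a = 'b] by (simp add: finite_image_iff)
qed

lemma eval3_eq_0_imp_eq_0:
  assumes "\<And>x y z :: complex. eval3 f x y z = 0"
  shows "f = 0"
proof -
  let ?F = "map_poly (map_poly (map_poly of_int)) f :: complex poly poly poly"
  \<comment> \<open>The variables are removed from the inside out: first x, then y, then z.\<close>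
  have "poly (poly ?F [:[:z:]:]) [:y:] = 0" for y z
    using assms by (simp add: eval3_def poly_all_0_iff_0[symmetric])
  then have "poly ?F [:[:z:]:] = 0" for z
    by (intro poly_eq_0_if_inj_roots[where g = "\<lambda>c. [:c:]"]) (auto simp: inj_def)
  then have "?F = 0"
    by (intro poly_eq_0_if_inj_roots[where g = "\<lambda>c. [:[:c:]:]"]) (auto simp: inj_def)
  then show ?thesis
    by (simp add: map_poly_eq_0_iff)
qed

lemma SL2C_pair_with_traces:
  obtains A B where "A \<in> carrier SL2C" "B \<in> carrier SL2C"
    "trace A = x" "trace B = y" "trace (A ** B) = z"
proof -
  \<comment> \<open>A root of t^2 - z t + 1. In \<open>A ** B\<close> the diagonal entries are z - b
    and b, and det B = b (z - b).\<close>
  define b where "b = (z + csqrt (z\<^sup>2 - 4)) / 2"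
  have b: "b * (z - b) = 1"
    by (simp add: b_def field_simps flip: power2_eq_square)
  define A B :: "complex^2^2"
    where "A = vector [vector [x, -1], vector [1, 0]]"
      and "B = vector [vector [0, b], vector [b - z, y]]"
  show ?thesis
  proof
    show "A \<in> carrier SL2C" "B \<in> carrier SL2C"
      using b by (simp_all add: SL2C_def A_def B_def det_2 algebra_simps)
    show "trace A = x" "trace B = y" "trace (A ** B) = z"
      by (simp_all add: A_def B_def trace_def matrix_matrix_mult_def sum_2)
  qed
qed

text \<open>Two candidates agree at every triple of traces, hence on all of complex 3-space, so
  their difference is the zero polynomial.\<close>

lemma trace_poly_eqI:
  assumes "\<And>A B. A \<in> carrier SL2C \<Longrightarrow> B \<in> carrier SL2C \<Longrightarrow>
    trace (word_eval w A B) = eval3 f (trace A) (trace B) (trace (A ** B))"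
  shows "trace_poly w = f"
  unfolding trace_poly_def
proof (rule the_equality)
  fix g
  assume g: "\<forall>A\<in>carrier SL2C. \<forall>B\<in>carrier SL2C.
    trace (word_eval w A B) = eval3 g (trace A) (trace B) (trace (A ** B))"
  have "eval3 (g - f) x y z = 0" for x y z :: complex
  proof -
    obtain A B where "A \<in> carrier SL2C" "B \<in> carrier SL2C"
      "trace A = x" "trace B = y" "trace (A ** B) = z"
      by (rule SL2C_pair_with_traces)
    then have "eval3 g x y z = eval3 f x y z"
      using g assms by metis
    then show ?thesis
      by (simp add: unital_ring_hom.hom_diff[OF unital_ring_hom_eval3])
  qed
  then show "g = f"
    using eval3_eq_0_imp_eq_0[of "g - f"] by simp
qed (use assms in blast)

section \<open>Coordinates with respect to I, A, B, AB\<close>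

text \<open>Left multiplication by a letter on the coordinates with respect to \<open>I, A, B, AB\<close>, where
  \<open>x = Tr A\<close>, \<open>y = Tr B\<close>, \<open>z = Tr (AB)\<close>.\<close>

fun letter_mult ::
  "'a::comm_ring_1 \<Rightarrow> 'a \<Rightarrow> 'a \<Rightarrow> gen letter \<Rightarrow> 'a \<times> 'a \<times> 'a \<times> 'a \<Rightarrow> 'a \<times> 'a \<times> 'a \<times> 'a" where
  "letter_mult x y z (gen_a, True) (p, q, r, s) = (- q, p + x * q, - s, r + x * s)"
| "letter_mult x y z (gen_a, False) (p, q, r, s) = (x * p + q, - p, x * r + s, - r)"
| "letter_mult x y z (gen_b, True) (p, q, r, s) =
    ((z - x * y) * q - r - x * s, y * q + s, p + x * q + y * r + z * s, - q)"
| "letter_mult x y z (gen_b, False) (p, q, r, s) =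
    (y * p - (z - x * y) * q + r + x * s, - s, - p - x * q - z * s, y * s + q)"

text \<open>The ring is left generic: the recursion runs over Z[x,y,z], over the complex numbers and
  over the integers. It starts from the coordinates of I.\<close>

definition word_coeffs ::
  "'a::comm_ring_1 \<Rightarrow> 'a \<Rightarrow> 'a \<Rightarrow> gen letter list \<Rightarrow> 'a \<times> 'a \<times> 'a \<times> 'a" where
  "word_coeffs x y z w = foldr (letter_mult x y z) w (1, 0, 0, 0)"

definition mat_comb ::
  "'a::comm_ring_1^2^2 \<Rightarrow> 'a^2^2 \<Rightarrow> 'a \<times> 'a \<times> 'a \<times> 'a \<Rightarrow> 'a^2^2" where
  "mat_comb A B = (\<lambda>(p, q, r, s). mat p + mat q ** A + mat r ** B + mat s ** (A ** B))"

definition comb_trace :: "'a::comm_ring_1 \<Rightarrow> 'a \<Rightarrow> 'a \<Rightarrow> 'a \<times> 'a \<times> 'a \<times> 'a \<Rightarrow> 'a" where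
  "comb_trace x y z = (\<lambda>(p, q, r, s). 2 * p + x * q + y * r + z * s)"

lemmas mat2_simps = vec_eq_iff forall_2 matrix_matrix_mult_def sum_2 mat_def trace_def det_2

lemma trace_mat_comb:
  "trace (mat_comb A B c) = comb_trace (trace A) (trace B) (trace (A ** B)) c"
  by (cases c) (simp add: mat_comb_def comb_trace_def mat2_simps algebra_simps)

text \<open>For determinant 1, Cayley-Hamilton reads (Tr A - A) A = I.\<close>

lemma inv_SL2C:
  assumes "A \<in> carrier SL2C"
  shows "inv\<^bsub>SL2C\<^esub> A = mat (trace A) - A"
proof -
  interpret group SL2C by (rule group_SL2C)
  have "det (mat (trace A) - A) = 1" "(mat (trace A) - A) ** A = mat 1"
    using assms by (auto simp: SL2C_def mat2_simps algebra_simps)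
  then show ?thesis
    using assms by (intro inv_equality) (simp_all add: SL2C_def)
qed

lemma mat_mult_nth: "(mat c ** (M :: 'a::comm_ring_1^'n^'m)) $ i $ j = c * M $ i $ j"
  by (simp add: matrix_matrix_mult_def mat_def if_distrib[of "\<lambda>t. t * _"] cong: if_cong)

lemma mult_mat: "M ** mat c = mat c ** (M :: 'a::comm_ring_1^'n^'m)"
  by (simp add: vec_eq_iff mat_mult_nth)
    (simp add: matrix_matrix_mult_def mat_def mult.commute
        if_distrib[of "\<lambda>t. _ * t"] cong: if_cong)

lemma mult_mat_mult: "M ** (mat c ** N) = mat c ** (M ** (N :: 'a::comm_ring_1^'n^'m))"
  by (simp add: matrix_mul_assoc mult_mat)

lemma matrix_add_rdistrib: "(N + N') ** M = N ** M + N' ** (M :: 'a::comm_ring_1^'n^'m)"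
  by (simp add: vec_eq_iff matrix_matrix_mult_def algebra_simps sum.distrib)

lemma matrix_diff_ldistrib: "M ** (N - N') = M ** N - M ** (N' :: 'a::comm_ring_1^'n^'m)"
  by (simp add: vec_eq_iff matrix_matrix_mult_def algebra_simps sum_subtractf)

lemma matrix_diff_rdistrib: "(N - N') ** M = N ** M - N' ** (M :: 'a::comm_ring_1^'n^'m)"
  by (simp add: vec_eq_iff matrix_matrix_mult_def algebra_simps sum_subtractf)

lemma cayley_hamilton_2:
  fixes A :: "'a::comm_ring_1^2^2"
  shows "A ** A = mat (trace A) ** A - mat (det A)"
  by (simp add: mat2_simps algebra_simps)

text \<open>This is the part of Cayley-Hamilton for A + B that is bilinear in A and B; it brings BA
  back into the span of I, A, B, AB.\<close>

lemma cayley_hamilton_2_polarized: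
  fixes A B :: "'a::comm_ring_1^2^2"
  shows "B ** A = mat (trace (A ** B) - trace A * trace B) + mat (trace B) ** A +
    mat (trace A) ** B - A ** B"
  by (simp add: mat2_simps algebra_simps)

lemmas mat_mult_simps = matrix_add_ldistrib matrix_diff_ldistrib matrix_add_rdistrib
  matrix_diff_rdistrib

lemma mult_mat_comb_left:
  assumes "det A = 1"
  shows "A ** mat_comb A B c = mat_comb A B (letter_mult (trace A) y z (gen_a, True) c)"
proof -
  have "A ** (A ** B) = mat (trace A) ** (A ** B) - B"
    by (simp add: matrix_mul_assoc cayley_hamilton_2[of A] assms matrix_diff_rdistrib)
  then show ?thesis
    by (cases c) (simp add: mat_comb_def mat_mult_simps mult_mat[of A]
        mult_mat_mult[of A] cayley_hamilton_2[of A] assms,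
      simp add: vec_eq_iff mat_mult_nth, simp add: mat_def algebra_simps)
qed

lemma mult_mat_comb_right:
  assumes "det B = 1"
  shows "B ** mat_comb A B c =
    mat_comb A B (letter_mult (trace A) (trace B) (trace (A ** B)) (gen_b, True) c)"
proof -
  \<comment> \<open>The only product not covered directly by the two identities: BA is expanded
    first, then B^2 is reduced.\<close>
  have "B ** (A ** B) = (B ** A) ** B"
    by (simp add: matrix_mul_assoc)
  also have "\<dots> = mat (trace (A ** B)) ** B - mat (trace A) + A"
    by (simp add: cayley_hamilton_2_polarized[where A = A and B = B] mat_mult_simps
        mult_mat_mult[of A] cayley_hamilton_2[of B] assms
        flip: matrix_mul_assoc, simp add: vec_eq_iff mat_mult_nth, simp add: mat_def algebra_simps)
  finally have "B ** (A ** B) = mat (trace (A ** B)) ** B - mat (trace A) + A" .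
  then show ?thesis
    by (cases c) (simp add: mat_comb_def mat_mult_simps mult_mat[of B]
        mult_mat_mult[of B] cayley_hamilton_2[of B] assms
        cayley_hamilton_2_polarized[where A = A and B = B],
      simp add: vec_eq_iff mat_mult_nth, simp add: mat_def algebra_simps)
qed

lemma letter_mult_mat_comb:
  assumes A: "A \<in> carrier SL2C" and B: "B \<in> carrier SL2C"
  shows "letter_value SL2C (\<lambda>g. case g of gen_a \<Rightarrow> A | gen_b \<Rightarrow> B) l ** mat_comb A B c =
    mat_comb A B (letter_mult (trace A) (trace B) (trace (A ** B)) l c)"
proof -
  let ?m = "letter_mult (trace A) (trace B) (trace (A ** B))"
  have det: "det A = 1" "det B = 1"
    using A B by (simp_all add: SL2C_def)
  \<comment> \<open>Since the inverse of A is Tr A - A, the clauses for inverse letters follow from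
    those for \<open>gen_a\<close> and \<open>gen_b\<close>.\<close>
  have inv: "mat (trace A) ** mat_comb A B c - mat_comb A B (?m (gen_a, True) c) =
      mat_comb A B (?m (gen_a, False) c)"
    "mat (trace B) ** mat_comb A B c - mat_comb A B (?m (gen_b, True) c) =
      mat_comb A B (?m (gen_b, False) c)"
    by (cases c; simp add: mat_comb_def vec_eq_iff mat_mult_nth; simp add: mat_def algebra_simps)+
  obtain g e where l: "l = (g, e)" by (cases l)
  show ?thesis
    using inv
    by (cases g; cases e)
      (simp_all add: l letter_value_def inv_SL2C[OF A] inv_SL2C[OF B] matrix_diff_rdistrib
        mult_mat_comb_left[OF det(1), where y = "trace B" and z = "trace (A ** B)"]
        mult_mat_comb_right[OF det(2)])
qed

lemma word_eval_eq_mat_comb: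
  assumes A: "A \<in> carrier SL2C" and B: "B \<in> carrier SL2C"
  shows "word_eval w A B =
    mat_comb A B (word_coeffs (trace A) (trace B) (trace (A ** B)) w)"
proof (induction w)
  case Nil
  show ?case
    by (simp add: word_eval_def free_lift_def SL2C_def word_coeffs_def mat_comb_def mat2_simps)
next
  case (Cons l w)
  have "word_eval (l # w) A B =
    letter_value SL2C (\<lambda>g. case g of gen_a \<Rightarrow> A | gen_b \<Rightarrow> B) l ** word_eval w A B"
    by (simp add: word_eval_def free_lift_def SL2C_def)
  then show ?case
    by (simp add: Cons.IH letter_mult_mat_comb[OF A B] word_coeffs_def)
qed

section \<open>Compatibility of the coordinates with ring homomorphisms\<close>

context unital_ring_hom
begin

definition hom4 :: "'a \<times> 'a \<times> 'a \<times> 'a \<Rightarrow> 'b \<times> 'b \<times> 'b \<times> 'b" where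
  "hom4 = (\<lambda>(p, q, r, s). (h p, h q, h r, h s))"

lemma hom4_letter_mult:
  "hom4 (letter_mult x y z l c) = letter_mult (h x) (h y) (h z) l (hom4 c)"
  by (cases "(x, y, z, l, c)" rule: letter_mult.cases)
    (simp_all add: hom4_def hom_add hom_mult hom_minus hom_diff)

lemma hom4_word_coeffs: "hom4 (word_coeffs x y z w) = word_coeffs (h x) (h y) (h z) w"
  by (induction w) (simp_all add: word_coeffs_def hom4_letter_mult,
    simp add: hom4_def hom_zero hom_one)

lemma hom_comb_trace: "h (comb_trace x y z c) = comb_trace (h x) (h y) (h z) (hom4 c)"
proof -
  have "h (2 * a) = 2 * h a" for a
    by (simp only: mult_2 hom_add)
  then show ?thesis
    by (simp add: comb_trace_def hom4_def hom_add hom_mult split: prod.split)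
qed

end

text \<open>Evaluation sends \<open>X3\<close>, \<open>Y3\<close>, \<open>Z3\<close> to x, y, z and
  commutes with the recursion. Complex values identify the trace polynomial; integer values give it
  at the origin.\<close>

lemma eval3_comb_trace_word_coeffs:
  "eval3 (comb_trace X3 Y3 Z3 (word_coeffs X3 Y3 Z3 w)) x y z =
    comb_trace x y z (word_coeffs x y z w)"
  by (simp add: unital_ring_hom.hom_comb_trace[OF unital_ring_hom_eval3]
      unital_ring_hom.hom4_word_coeffs[OF unital_ring_hom_eval3])

lemma trace_poly_eq: "trace_poly w = comb_trace X3 Y3 Z3 (word_coeffs X3 Y3 Z3 w)"
  by (rule trace_poly_eqI)
    (simp add: eval3_comb_trace_word_coeffs word_eval_eq_mat_comb trace_mat_comb)

section \<open>Specialization at the origin\<close>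

text \<open>The elements 1, i, j, k and their negatives, with A, B, AB in the roles of i, j,
  k.\<close>

definition quaternion_units :: "(int \<times> int \<times> int \<times> int) set" where
  "quaternion_units = (\<Union>e\<in>{1, -1}. {(e, 0, 0, 0), (0, e, 0, 0), (0, 0, e, 0), (0, 0, 0, e)})"

text \<open>At x = y = z = 0 the relations become A^2 = B^2 = -I and BA = -AB, so each letter
  permutes the coordinates up to sign.\<close>

lemma word_coeffs_0_quaternion_units: "word_coeffs 0 0 0 w \<in> quaternion_units"
proof (induction w)
  case (Cons l w)
  have "letter_mult 0 0 0 l c \<in> quaternion_units" if "c \<in> quaternion_units" for c
    using that
    by (cases "(0 :: int, 0 :: int, 0 :: int, l, c)" rule: letter_mult.cases)
      (auto simp: quaternion_units_def)
  then show ?case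
    using Cons.IH by (simp add: word_coeffs_def)
qed (simp add: word_coeffs_def quaternion_units_def)

theorem theorem1p4:
  fixes w :: "gen letter list"
  assumes "w \<in> carrier F_ab"
  shows "eval3 (trace_poly w) (0::int) 0 0 \<in> {-2, 0, 2}"
  using word_coeffs_0_quaternion_units[of w]
  by (simp add: trace_poly_eq eval3_comb_trace_word_coeffs)
    (auto simp: comb_trace_def quaternion_units_def)

end
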